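(* Let $p=1$ and suppose there is no boundary penalty ($\beta=0$). Assume that $K1=0$. Let $f^*\in BV(\Omega)$ with polar decomposition $Df^*=\boldsymbol{\nu}^*|Df^*|$, and assume that for every $z\in\partial\Omega$ at least one of the following two conditions holds: $$\operatorname{sgn}\bigl\{(K[\nabla G(\cdot;y)\cdot\boldsymbol{\nu}^*(y)])(z)\bigr\}\ge 0\quad\text{for all } y\in\Omega,$$ or $$\operatorname{sgn}\bigl\{(K[\nabla G(\cdot;y)\cdot\boldsymbol{\nu}^*(y)])(z)\bigr\}\le 0\quad\text{for all } y\in\Omega.$$ Let $\boldsymbol{q}$ be any map on $\Omega$ with $$\boldsymbol{q}(y)\in\operatorname*{arg\,max}_{\boldsymbol{d}\in\mathbb{R}^2,\ |\boldsymbol{d}|_2=1}\bigl\|K(\nabla G(\cdot;y)\cdot\boldsymbol{d})\bigr\|_{L^1(\partial\Omega)},\qquad y\in\Omega .$$ If $$\boldsymbol{\nu}^*(y)=\boldsymbol{q}(y)\quad\text{for } |Df^*|\text{-a.e. } y,$$ then $$f^*\in\operatorname*{arg\,min}_{g\in BV(\Omega)}\operatorname{TV}_{w}(g)\quad\text{subject to}\quad Kg=Kf^*,$$ where $\operatorname{TV}_w(g)=\int_\Omega w(y)\,d|Dg|(y)$ and $w(y)=\sup_{|\boldsymbol{d}|_2=1}\bigl\|K(\nabla G(\cdot;y)\cdot\boldsymbol{d})\bigr\|_{L^1(\partial\Omega)}$.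
   Context: $\Omega\subset\mathbb{R}^2$ is a bounded Lipschitz domain and $K:L^2(\Omega)\to L^2(\partial\Omega)$ is a linear operator; $1$ denotes the constant function. For $g\in BV(\Omega)$, $Dg$ is the vector-valued Radon measure derivative with total variation measure $|Dg|$ and polar decomposition $Dg=\boldsymbol{\nu}_g|Dg|$, $|\boldsymbol{\nu}_g|_2=1$ $|Dg|$-a.e.; a Borel representative of $\boldsymbol{\nu}_g$ is fixed (at points where the polar decomposition does not determine a direction it may be set to $0$). $\boldsymbol{\nu}^*=\boldsymbol{\nu}_{f^*}$. $G$ is the Neumann Green's function (symmetric, unique up to an additive constant): $-\Delta_yG(y;x)=\delta_x(y)-\frac1{|\Omega|}$ for $y\in\Omega$, $\nabla_yG(y;x)\cdot\boldsymbol{n}(y)=0$ for $y\in\partial\Omega$. The notation $\nabla G(\cdot;y)$ means the gradient of $G(x;y)$ with respect to $y$, regarded as a function of the first variable $x$, so that for $f\in BV(\Omega)$ $$f(x)=\int_\Omega\nabla G(x;y)\cdot\boldsymbol{\nu}_f(y)\,d|Df|(y)+\frac1{|\Omega|}\int_\Omega f(y)\,dy.$$ $K$ acts on the variable $x$. Standing convention: for $y\in\Omega$ and $\boldsymbol{d}\in\mathbb{R}^2$ the function $K(\nabla G(\cdot;y)\cdot\boldsymbol{d})$ on $\partial\Omega$ is well defined with pointwise values, is linear in $\boldsymbol{d}$, belongs to $L^1(\partial\Omega)$ and is jointly measurable in $(z,y)\in\partial\Omega\times\Omega$; and $K$ may be interchanged with the integral in the representation formula, i.e. (since $K1=0$)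 for every $f\in BV(\Omega)$, $$(Kf)(z)=\int_\Omega\bigl(K(\nabla G(\cdot;y)\cdot\boldsymbol{\nu}_f(y))\bigr)(z)\,d|Df|(y)\quad\text{for a.e. } z\in\partial\Omega.$$ *)

theory Defs
  imports "HOL-Analysis.Analysis"
begin

type_synonym plane = "real^2"

section \<open>Domains and boundary measure\<close>

definition bounded_lipschitz_domain :: "plane set \<Rightarrow> bool" where
  "bounded_lipschitz_domain \<Omega> \<longleftrightarrow>
     open \<Omega> \<and> connected \<Omega> \<and> \<Omega> \<noteq> {} \<and> bounded \<Omega> \<and>
     (\<forall>p\<in>frontier \<Omega>. \<exists>r>0. \<exists>e1 e2. \<exists>\<gamma>::real \<Rightarrow> real. \<exists>L.
        norm e1 = 1 \<and> norm e2 = 1 \<and> e1 \<bullet> e2 = 0 \<and> L-lipschitz_on UNIV \<gamma> \<and>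
        \<Omega> \<inter> ball p r = {x \<in> ball p r. \<gamma> (x \<bullet> e1) < x \<bullet> e2})"

text \<open>One-dimensional Hausdorff measure. The sets of a cover are required to be bounded because
  the diameter of an unbounded set is a meaningless real number. In dimension one the normalising constant is 1,
  so this is arc length on rectifiable curves.\<close>

definition hausdorff1_content :: "real \<Rightarrow> plane set \<Rightarrow> ennreal" where
  "hausdorff1_content \<delta> A =
     (INF U\<in>{U :: nat \<Rightarrow> plane set.
        A \<subseteq> (\<Union>i. U i) \<and> (\<forall>i. bounded (U i) \<and> diameter (U i) \<le> \<delta>)}.
      \<Sum>i. ennreal (diameter (U i)))"

definition hausdorff1 :: "plane set \<Rightarrow> ennreal" where
  "hausdorff1 A = (SUP \<delta>\<in>{0<..}. hausdorff1_content \<delta> A)"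

definition hausdorff1_measure :: "plane measure" where
  "hausdorff1_measure = measure_of UNIV (sets borel) hausdorff1"

text \<open>The surface measure is completed, to match the Lebesgue measure used on the domain.\<close>

definition surface_measure :: "plane set \<Rightarrow> plane measure" where
  "surface_measure \<Omega> = completion (restrict_space hausdorff1_measure (frontier \<Omega>))"

section \<open>Lebesgue spaces and linear operators\<close>

text \<open>Elements of the Lebesgue spaces are represented by functions; equality in these spaces is
  equality almost everywhere.\<close>

definition L2_space :: "'a measure \<Rightarrow> ('a \<Rightarrow> real) set" where
  "L2_space M = {f. f \<in> borel_measurable M \<and> integrable M (\<lambda>x. (f x)\<^sup>2)}"

definition L1_norm :: "'a measure \<Rightarrow> ('a \<Rightarrow> real) \<Rightarrow> ennreal" where
  "L1_norm M f = (\<integral>\<^sup>+x. ennreal \<bar>f x\<bar> \<partial>M)"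

text \<open>Only the restriction of \<open>K\<close> to \<open>L2_space M\<close> matters here; \<open>K\<close> has to descend to classes of
  functions that agree almost everywhere, and to be linear on these classes.\<close>

definition linear_operator_L2 ::
  "'a measure \<Rightarrow> 'b measure \<Rightarrow> (('a \<Rightarrow> real) \<Rightarrow> ('b \<Rightarrow> real)) \<Rightarrow> bool" where
  "linear_operator_L2 M N K \<longleftrightarrow>
     (\<forall>f\<in>L2_space M. K f \<in> L2_space N) \<and>
     (\<forall>f\<in>L2_space M. \<forall>g\<in>L2_space M. (AE x in M. f x = g x) \<longrightarrow> (AE z in N. K f z = K g z)) \<and>
     (\<forall>f\<in>L2_space M. \<forall>g\<in>L2_space M. AE z in N. K (\<lambda>x. f x + g x) z = K f z + K g z) \<and>
     (\<forall>f\<in>L2_space M. \<forall>c. AE z in N. K (\<lambda>x. c * f x) z = c * K f z)"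

section \<open>Differentiable functions\<close>

definition gradient :: "(plane \<Rightarrow> real) \<Rightarrow> plane \<Rightarrow> plane" where
  "gradient u x = (THE D. GDERIV u x :> D)"

definition C1_function :: "(plane \<Rightarrow> real) \<Rightarrow> bool" where
  "C1_function u \<longleftrightarrow> (\<forall>x. u differentiable (at x)) \<and> continuous_on UNIV (gradient u)"

definition test_fields :: "plane set \<Rightarrow> (plane \<Rightarrow> plane) set" where
  "test_fields \<Omega> =
     {\<phi>. (\<forall>i. C1_function (\<lambda>x. \<phi> x $ i)) \<and>
         compact (closure {x. \<phi> x \<noteq> 0}) \<and> closure {x. \<phi> x \<noteq> 0} \<subseteq> \<Omega>}"

definition divergence :: "(plane \<Rightarrow> plane) \<Rightarrow> plane \<Rightarrow> real" where
  "divergence \<phi> x = (\<Sum>i\<in>UNIV. gradient (\<lambda>x. \<phi> x $ i) x $ i)"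

section \<open>Vector measures and functions of bounded variation\<close>

abbreviation borel_subsets :: "plane set \<Rightarrow> plane set set" where
  "borel_subsets \<Omega> \<equiv> sets (restrict_space borel \<Omega>)"

definition vector_measure :: "plane set \<Rightarrow> (plane set \<Rightarrow> plane) \<Rightarrow> bool" where
  "vector_measure \<Omega> D \<longleftrightarrow>
     D {} = 0 \<and>
     (\<forall>A :: nat \<Rightarrow> plane set. range A \<subseteq> borel_subsets \<Omega> \<and> disjoint_family A \<longrightarrow>
        (\<lambda>i. D (A i)) sums D (\<Union>i. A i))"

definition total_variation :: "plane set \<Rightarrow> (plane set \<Rightarrow> plane) \<Rightarrow> plane set \<Rightarrow> ennreal" where
  "total_variation \<Omega> D B =
     (SUP A\<in>{A :: nat \<Rightarrow> plane set.
        range A \<subseteq> borel_subsets \<Omega> \<and> disjoint_family A \<and> (\<Union>i. A i) = B}.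
      \<Sum>i. ennreal (norm (D (A i))))"

definition variation_measure :: "plane set \<Rightarrow> (plane set \<Rightarrow> plane) \<Rightarrow> plane measure" where
  "variation_measure \<Omega> D = measure_of \<Omega> (borel_subsets \<Omega>) (total_variation \<Omega> D)"

definition polar_decomposition ::
  "plane set \<Rightarrow> (plane set \<Rightarrow> plane) \<Rightarrow> (plane \<Rightarrow> plane) \<Rightarrow> bool" where
  "polar_decomposition \<Omega> D \<nu> \<longleftrightarrow>
     \<nu> \<in> borel_measurable (restrict_space borel \<Omega>) \<and>
     (AE y in variation_measure \<Omega> D. norm (\<nu> y) = 1) \<and>
     (\<forall>B\<in>borel_subsets \<Omega>. D B = (LINT y:B|variation_measure \<Omega> D. \<nu> y))"

text \<open>\<open>D\<close> is the distributional derivative of \<open>g\<close> and a finite vector measure. The integral of a test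
  field against \<open>D\<close> is expressed through the polar decomposition of \<open>D\<close>, which always exists.\<close>

definition has_BV_derivative :: "plane set \<Rightarrow> (plane \<Rightarrow> real) \<Rightarrow> (plane set \<Rightarrow> plane) \<Rightarrow> bool" where
  "has_BV_derivative \<Omega> g D \<longleftrightarrow>
     vector_measure \<Omega> D \<and> total_variation \<Omega> D \<Omega> < \<infinity> \<and>
     (\<exists>\<nu>. polar_decomposition \<Omega> D \<nu> \<and>
        (\<forall>\<phi>\<in>test_fields \<Omega>.
           (LINT x|lebesgue_on \<Omega>. g x * divergence \<phi> x) =
             - (LINT y|variation_measure \<Omega> D. \<phi> y \<bullet> \<nu> y)))"

definition BV :: "plane set \<Rightarrow> (plane \<Rightarrow> real) set" where
  "BV \<Omega> = {g. integrable (lebesgue_on \<Omega>) g \<and> (\<exists>D. has_BV_derivative \<Omega> g D)}"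

text \<open>The derivative is unique on the Borel subsets of the domain; the choice below only concerns
  its irrelevant values on other sets.\<close>

definition BV_deriv :: "plane set \<Rightarrow> (plane \<Rightarrow> real) \<Rightarrow> plane set \<Rightarrow> plane" where
  "BV_deriv \<Omega> g = (SOME D. has_BV_derivative \<Omega> g D)"

definition BV_variation :: "plane set \<Rightarrow> (plane \<Rightarrow> real) \<Rightarrow> plane measure" where
  "BV_variation \<Omega> g = variation_measure \<Omega> (BV_deriv \<Omega> g)"

definition weighted_TV :: "plane set \<Rightarrow> (plane \<Rightarrow> ennreal) \<Rightarrow> (plane \<Rightarrow> real) \<Rightarrow> ennreal" where
  "weighted_TV \<Omega> w g = (\<integral>\<^sup>+y. w y \<partial>BV_variation \<Omega> g)"

section \<open>The Neumann Green's function\<close>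

text \<open>The argument order is \<open>G y x\<close> for $G(y;x)$, with pole \<open>x\<close>. The integral identity is the
  weak form of
    $-\Delta_y G(y;x) = \delta_x(y) - 1/|\Omega|$ in $\Omega$,
    $\nabla_y G(y;x) \cdot n(y) = 0$ on $\partial\Omega$:
  the test functions do not have to vanish on the boundary, which encodes the Neumann condition
  (a Lipschitz boundary has a normal only almost everywhere). Square integrability of the gradient
  away from the pole makes \<open>G\<close> unique up to an additive constant; without it, singular harmonic
  functions at reentrant corners could be added.\<close>

definition neumann_green :: "plane set \<Rightarrow> (plane \<Rightarrow> plane \<Rightarrow> real) \<Rightarrow> bool" where
  "neumann_green \<Omega> G \<longleftrightarrow>
     (\<forall>x\<in>\<Omega>. \<forall>y\<in>\<Omega>. G x y = G y x) \<and>
     (\<forall>x\<in>\<Omega>.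
        (\<forall>y\<in>\<Omega> - {x}. (\<lambda>y. G y x) differentiable (at y)) \<and>
        integrable (lebesgue_on \<Omega>) (\<lambda>y. G y x) \<and>
        integrable (lebesgue_on \<Omega>) (gradient (\<lambda>y. G y x)) \<and>
        (\<forall>r>0. integrable (lebesgue_on (\<Omega> - ball x r)) (\<lambda>y. (norm (gradient (\<lambda>y. G y x) y))\<^sup>2)) \<and>
        (\<forall>\<phi>. C1_function \<phi> \<longrightarrow>
           (LINT y|lebesgue_on \<Omega>. gradient (\<lambda>y. G y x) y \<bullet> gradient \<phi> y) =
             \<phi> x - (1 / measure lebesgue \<Omega>) * (LINT y|lebesgue_on \<Omega>. \<phi> y)))"

text \<open>The function $K(\nabla G(\cdot;y) \cdot d)$ on the boundary: the gradient is taken in the second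
  variable, while \<open>K\<close> acts on the first one.\<close>

definition K_gradG ::
  "((plane \<Rightarrow> real) \<Rightarrow> (plane \<Rightarrow> real)) \<Rightarrow> (plane \<Rightarrow> plane \<Rightarrow> real) \<Rightarrow>
     plane \<Rightarrow> plane \<Rightarrow> plane \<Rightarrow> real" where
  "K_gradG K G y d = K (\<lambda>x. gradient (\<lambda>y'. G x y') y \<bullet> d)"

definition weight ::
  "plane set \<Rightarrow> ((plane \<Rightarrow> real) \<Rightarrow> (plane \<Rightarrow> real)) \<Rightarrow> (plane \<Rightarrow> plane \<Rightarrow> real) \<Rightarrow> plane \<Rightarrow> ennreal" where
  "weight \<Omega> K G y = (SUP d\<in>{d. norm d = 1}. L1_norm (surface_measure \<Omega>) (K_gradG K G y d))"

end

theory Submission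
  imports Defs
begin

text \<open>
  Write \<open>\<Phi>\<^sub>f(z, y)\<close> for the value at \<open>z\<close> of \<open>K\<close> applied to the dipole field at \<open>y\<close> in the direction
  \<open>\<nu>\<^sub>f(y)\<close>. The representation formula gives \<open>K f(z) = \<integral> \<Phi>\<^sub>f(z, y) d|Df|(y)\<close>, so Tonelli's theorem
  and the triangle inequality for integrals bound the data from above by the regularizer: for every
  \<open>g\<close> of bounded variation,
    \<open>\<parallel>K g\<parallel>\<^sub>L\<^sub>1 \<le> \<integral>\<integral> |\<Phi>\<^sub>g(z, y)| d|Dg|(y) dz = \<integral> \<parallel>\<Phi>\<^sub>g(\<cdot>, y)\<parallel>\<^sub>L\<^sub>1 d|Dg|(y) \<le> TV\<^sub>w(g)\<close>.
  For \<open>f\<^sup>*\<close> both inequalities are equalities. The first is one because \<open>\<Phi>\<^sub>f\<^sub>*(z, \<cdot>)\<close> does not change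
  sign, so nothing cancels in the integral over \<open>y\<close>; the second because \<open>\<nu>\<^sup>* = q\<close> attains the
  supremum that defines \<open>w\<close>. Hence \<open>TV\<^sub>w(f\<^sup>*) = \<parallel>K f\<^sup>*\<parallel>\<^sub>L\<^sub>1 = \<parallel>K g\<parallel>\<^sub>L\<^sub>1 \<le> TV\<^sub>w(g)\<close> for every competitor.

  The analytic content is the exchange of integrals, \<open>nn_integral_L1_norm_swap\<close>, for a jointly
  measurable integrand and two finite measures. Measurability follows from linearity in the
  direction, by expanding \<open>\<nu>\<^sub>f(y)\<close> in coordinates (\<open>measurable_linear_in_varying_direction\<close>).
  Finiteness of \<open>|Df|\<close> is part of bounded variation. Finiteness of the surface measure
  (\<open>finite_measure_surface\<close>) is where the Lipschitz boundary enters: the boundary is compact and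
  locally contained in a Lipschitz image of an interval, hence of finite length.
\<close>

section \<open>Finiteness of the measures\<close>

text \<open>When the set function fails to be a measure, \<open>measure_of\<close> yields the zero measure, so the
  inequality holds for every set function. It bounds the Hausdorff and variation measures by their
  defining set functions without a proof that these are countably additive.\<close>

lemma emeasure_measure_of_le: "emeasure (measure_of X S \<mu>) A \<le> \<mu> A"
  by (simp add: emeasure_measure_of_conv)

lemma hausdorff1_mono:
  assumes "A \<subseteq> B"
  shows "hausdorff1 A \<le> hausdorff1 B"
  unfolding hausdorff1_def hausdorff1_content_def
  using assms by (intro SUP_mono' INF_superset_mono) auto

text \<open>The factor 2 is an artefact of cutting the interval into \<open>n\<close> pieces but covering the curve
  by \<open>n + 1\<close> of them, so that the right endpoint needs no separate treatment.\<close>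

lemma hausdorff1_lipschitz_image_le:
  fixes F :: "real \<Rightarrow> plane"
  assumes F: "C-lipschitz_on UNIV F" and "a < b"
  shows "hausdorff1 (F ` {a..b}) \<le> ennreal (2 * C * (b - a))"
  unfolding hausdorff1_def
proof (rule SUP_least)
  fix \<delta> :: real assume "\<delta> \<in> {0<..}"
  then have \<delta>: "\<delta> > 0" by simp
  have C: "C \<ge> 0" using F by (rule lipschitz_on_nonneg)
  obtain m :: nat where m: "C * (b - a) / \<delta> \<le> real m"
    using real_arch_simple by blast
  define n where "n = Suc m"
  define h where "h = (b - a) / real n"
  have n: "real n \<ge> 1" "C * (b - a) / \<delta> \<le> real n" using m by (simp_all add: n_def)
  have h: "h > 0" using \<open>a < b\<close> n by (simp add: h_def)
  have nh: "real n * h = b - a" using n by (simp add: h_def)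
  have Ch: "C * h \<le> \<delta>"
    using n \<delta> by (simp add: h_def field_simps)
  define U where
    "U = (\<lambda>i. if i < Suc n then F ` {a + real i * h .. a + (real i + 1) * h} else {})"
  have dist_F: "norm (F s - F t) \<le> C * \<bar>s - t\<bar>" for s t
    using lipschitz_onD[OF F, of s t] by (simp add: dist_norm)
  have diam: "diameter (U i) \<le> C * h" for i
  proof (rule diameter_le)
    show "U i \<noteq> {} \<or> 0 \<le> C * h" using C h by simp
    fix x y assume "x \<in> U i" "y \<in> U i"
    then obtain s t where st: "x = F s" "y = F t"
      "s \<in> {a + real i * h .. a + (real i + 1) * h}" "t \<in> {a + real i * h .. a + (real i + 1) * h}"
      by (auto simp: U_def split: if_splits)
    then have "\<bar>s - t\<bar> \<le> h" by (auto simp: algebra_simps abs_le_iff)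
    then have "C * \<bar>s - t\<bar> \<le> C * h" using C by (rule mult_left_mono)
    then show "norm (x - y) \<le> C * h" using dist_F[of s t] st by simp
  qed
  have bdd: "bounded (U i)" for i
    using F by (auto simp: U_def intro!: compact_imp_bounded compact_continuous_image
        intro: continuous_on_subset lipschitz_on_continuous_on)
  have cover: "F ` {a..b} \<subseteq> (\<Union>i. U i)"
  proof clarify
    fix t assume t: "t \<in> {a..b}"
    define i where "i = nat \<lfloor>(t - a) / h\<rfloor>"
    have pos: "(t - a) / h \<ge> 0" using t h by simp
    have i: "real i \<le> (t - a) / h" "(t - a) / h < real i + 1"
      using pos by (simp_all add: i_def)
    have "(t - a) / h \<le> real n"
      using t h nh by (simp add: field_simps)
    then have "i < Suc n" using i by linarith
    moreover have "t \<in> {a + real i * h .. a + (real i + 1) * h}"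
      using i h by (simp add: field_simps)
    ultimately have "F t \<in> U i" by (auto simp: U_def)
    then show "F t \<in> (\<Union>i. U i)" by blast
  qed
  have "hausdorff1_content \<delta> (F ` {a..b}) \<le> (\<Sum>i. ennreal (diameter (U i)))"
    unfolding hausdorff1_content_def
    using cover bdd order_trans[OF diam Ch] by (intro INF_lower) auto
  also have "\<dots> = (\<Sum>i<Suc n. ennreal (diameter (U i)))"
    by (rule suminf_finite) (auto simp: U_def)
  also have "\<dots> \<le> (\<Sum>i<Suc n. ennreal (C * h))"
    by (intro sum_mono ennreal_leI diam)
  also have "\<dots> = ennreal (\<Sum>i<Suc n. C * h)"
    using C h by (intro sum_ennreal) simp
  also have "(\<Sum>i<Suc n. C * h) = C * (real n * h) + C * h"
    by (simp add: algebra_simps)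
  also have "\<dots> \<le> 2 * C * (b - a)"
  proof -
    have "h \<le> b - a" using n h nh mult_right_mono[of 1 "real n" h] by simp
    then have "C * h \<le> C * (b - a)" using C by (rule mult_left_mono)
    then show ?thesis using nh by simp
  qed
  finally show "hausdorff1_content \<delta> (F ` {a..b}) \<le> ennreal (2 * C * (b - a))"
    by (simp add: ennreal_leI)
qed

lemma plane_orthonormal_expansion:
  fixes x e1 e2 :: plane
  assumes e: "norm e1 = 1" "norm e2 = 1" "e1 \<bullet> e2 = 0"
  shows "x = (x \<bullet> e1) *\<^sub>R e1 + (x \<bullet> e2) *\<^sub>R e2"
proof -
  have e': "e1 \<bullet> e1 = 1" "e2 \<bullet> e2 = 1" using e by (simp_all add: dot_square_norm)
  have ne: "e1 \<noteq> e2" "e1 \<noteq> 0" "e2 \<noteq> 0" using e e' by auto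
  have "independent {e1, e2}"
    using e ne by (intro pairwise_orthogonal_independent)
      (auto simp: pairwise_def orthogonal_def inner_commute)
  then have span: "UNIV \<subseteq> span {e1, e2}"
    using ne by (intro card_ge_dim_independent) auto
  define w where "w = x - ((x \<bullet> e1) *\<^sub>R e1 + (x \<bullet> e2) *\<^sub>R e2)"
  have "w \<bullet> e1 = 0" "w \<bullet> e2 = 0"
    using e e' inner_commute[of e2 e1] by (simp_all add: w_def inner_diff_left inner_add_left)
  then have "orthogonal w y" if "y \<in> {e1, e2}" for y
    using that by (auto simp: orthogonal_def)
  then have "orthogonal w w"
    using span by (intro orthogonal_to_span[of w "{e1, e2}"]) auto
  then show ?thesis by (simp add: orthogonal_def w_def)
qed

text \<open>Near each of its points the boundary lies on the graph of \<open>\<gamma>\<close>: the points strictly above the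
  graph belong to the open set \<open>\<Omega>\<close>, and those strictly below form an open set that misses \<open>\<Omega>\<close>.
  The graph over a bounded interval is a Lipschitz curve, of finite length.\<close>

lemma hausdorff1_frontier_locally_finite:
  assumes \<Omega>: "bounded_lipschitz_domain \<Omega>" and p: "p \<in> frontier \<Omega>"
  shows "\<exists>r>0. hausdorff1 (frontier \<Omega> \<inter> ball p r) < \<infinity>"
proof -
  have "open \<Omega>" using \<Omega> by (simp add: bounded_lipschitz_domain_def)
  obtain r e1 e2 and \<gamma> :: "real \<Rightarrow> real" and L where r: "r > 0"
    and e: "norm e1 = 1" "norm e2 = 1" "e1 \<bullet> e2 = 0" and \<gamma>: "L-lipschitz_on UNIV \<gamma>"
    and graph: "\<Omega> \<inter> ball p r = {x \<in> ball p r. \<gamma> (x \<bullet> e1) < x \<bullet> e2}"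
    using \<Omega> p unfolding bounded_lipschitz_domain_def by blast
  define F where "F t = t *\<^sub>R e1 + \<gamma> t *\<^sub>R e2" for t
  have L: "L \<ge> 0" using \<gamma> by (rule lipschitz_on_nonneg)
  have F: "(1 + L)-lipschitz_on UNIV F"
  proof (rule lipschitz_onI)
    fix s t :: real
    have "F s - F t = (s - t) *\<^sub>R e1 + (\<gamma> s - \<gamma> t) *\<^sub>R e2"
      by (simp add: F_def algebra_simps)
    then have "norm (F s - F t) \<le> norm ((s - t) *\<^sub>R e1) + norm ((\<gamma> s - \<gamma> t) *\<^sub>R e2)"
      by (metis norm_triangle_ineq)
    also have "\<dots> = \<bar>s - t\<bar> + \<bar>\<gamma> s - \<gamma> t\<bar>" using e by simp
    also have "\<bar>\<gamma> s - \<gamma> t\<bar> \<le> L * \<bar>s - t\<bar>"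
      using lipschitz_onD[OF \<gamma>, of s t] by (simp add: dist_real_def)
    finally show "dist (F s) (F t) \<le> (1 + L) * dist s t"
      by (simp add: dist_norm algebra_simps)
  qed (use L in simp)
  have cont: "continuous_on UNIV (\<lambda>x. \<gamma> (x \<bullet> e1))"
    by (rule continuous_on_compose2[OF lipschitz_on_continuous_on[OF \<gamma>]])
      (auto intro!: continuous_intros)
  have on_graph: "\<gamma> (x \<bullet> e1) = x \<bullet> e2" if x: "x \<in> frontier \<Omega>" "x \<in> ball p r" for x
  proof (rule ccontr)
    assume "\<gamma> (x \<bullet> e1) \<noteq> x \<bullet> e2"
    then consider "\<gamma> (x \<bullet> e1) < x \<bullet> e2" | "x \<bullet> e2 < \<gamma> (x \<bullet> e1)" by linarith
    then show False
    proof cases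
      case 1
      then have "x \<in> \<Omega>" using graph x by blast
      then show False using x \<open>open \<Omega>\<close> by (simp add: frontier_def interior_open)
    next
      case 2
      define V where "V = {x. x \<bullet> e2 < \<gamma> (x \<bullet> e1)} \<inter> ball p r"
      have "open V" unfolding V_def
        using cont by (intro open_Int open_Collect_less open_ball continuous_intros)
      moreover have "V \<inter> \<Omega> = {}"
      proof (rule equals0I)
        fix y assume y: "y \<in> V \<inter> \<Omega>"
        then have "y \<in> \<Omega> \<inter> ball p r" by (simp add: V_def)
        then have "\<gamma> (y \<bullet> e1) < y \<bullet> e2" unfolding graph by simp
        then show False using y by (simp add: V_def)
      qed
      ultimately have "V \<inter> closure \<Omega> = {}" by (simp add: open_Int_closure_eq_empty)
      then show False using 2 x by (auto simp: V_def frontier_def)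
    qed
  qed
  have "frontier \<Omega> \<inter> ball p r \<subseteq> F ` {p \<bullet> e1 - r .. p \<bullet> e1 + r}"
  proof
    fix x assume x: "x \<in> frontier \<Omega> \<inter> ball p r"
    have "\<bar>x \<bullet> e1 - p \<bullet> e1\<bar> \<le> norm (x - p) * norm e1"
      by (metis Cauchy_Schwarz_ineq2 inner_diff_left)
    also have "\<dots> \<le> r" using x e by (simp add: dist_norm norm_minus_commute)
    finally have "x \<bullet> e1 \<in> {p \<bullet> e1 - r .. p \<bullet> e1 + r}" by (auto simp: abs_le_iff)
    moreover have "x = F (x \<bullet> e1)"
      using plane_orthonormal_expansion[OF e, of x] on_graph x by (simp add: F_def)
    ultimately show "x \<in> F ` {p \<bullet> e1 - r .. p \<bullet> e1 + r}" by blast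
  qed
  then have "hausdorff1 (frontier \<Omega> \<inter> ball p r) \<le> hausdorff1 (F ` {p \<bullet> e1 - r .. p \<bullet> e1 + r})"
    by (rule hausdorff1_mono)
  also have "\<dots> \<le> ennreal (2 * (1 + L) * (p \<bullet> e1 + r - (p \<bullet> e1 - r)))"
    using F r by (intro hausdorff1_lipschitz_image_le) auto
  also have "\<dots> < \<infinity>" by simp
  finally show ?thesis using r by blast
qed

lemma space_surface_measure: "space (surface_measure \<Omega>) = frontier \<Omega>"
  by (simp add: surface_measure_def hausdorff1_measure_def space_restrict_space space_measure_of_conv)

lemma finite_measure_surface:
  assumes \<Omega>: "bounded_lipschitz_domain \<Omega>"
  shows "finite_measure (surface_measure \<Omega>)"
proof (rule finite_measureI)
  have sets_H: "sets hausdorff1_measure = sets borel"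
    unfolding hausdorff1_measure_def using sets.sigma_sets_eq[of "borel :: plane measure"]
    by (simp add: sets_measure_of_conv)
  have fr: "frontier \<Omega> \<in> sets hausdorff1_measure"
    by (simp add: sets_H borel_closed)
  have "compact (frontier \<Omega>)"
    using \<Omega> by (simp add: bounded_lipschitz_domain_def compact_frontier_bounded)
  obtain r where r: "r p > 0" "hausdorff1 (frontier \<Omega> \<inter> ball p (r p)) < \<infinity>"
    if "p \<in> frontier \<Omega>" for p
    using hausdorff1_frontier_locally_finite[OF \<Omega>] by metis
  have "frontier \<Omega> \<subseteq> (\<Union>p\<in>frontier \<Omega>. ball p (r p))" using r by force
  then obtain P where P: "P \<subseteq> frontier \<Omega>" "finite P" "frontier \<Omega> \<subseteq> (\<Union>p\<in>P. ball p (r p))"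
    using compactE_image[OF \<open>compact (frontier \<Omega>)\<close>, of "frontier \<Omega>" "\<lambda>p. ball p (r p)"] by auto
  have "emeasure hausdorff1_measure (frontier \<Omega>)
      = emeasure hausdorff1_measure (\<Union>p\<in>P. frontier \<Omega> \<inter> ball p (r p))"
    using P by (intro arg_cong[where f = "emeasure hausdorff1_measure"]) blast
  also have "\<dots> \<le> (\<Sum>p\<in>P. emeasure hausdorff1_measure (frontier \<Omega> \<inter> ball p (r p)))"
    using P fr by (intro emeasure_subadditive_finite) (auto simp: sets_H)
  also have "\<dots> \<le> (\<Sum>p\<in>P. hausdorff1 (frontier \<Omega> \<inter> ball p (r p)))"
    unfolding hausdorff1_measure_def by (intro sum_mono emeasure_measure_of_le)
  also have "\<dots> < \<infinity>" using P r by (auto intro!: ennreal_sum_less_top)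
  finally have "emeasure hausdorff1_measure (frontier \<Omega>) < \<infinity>" .
  moreover have "emeasure (surface_measure \<Omega>) (frontier \<Omega>) = emeasure hausdorff1_measure (frontier \<Omega>)"
    using fr by (simp add: surface_measure_def emeasure_completion sets_restrict_space_iff
        emeasure_restrict_space hausdorff1_measure_def space_measure_of_conv)
  ultimately show "emeasure (surface_measure \<Omega>) (space (surface_measure \<Omega>)) \<noteq> \<infinity>"
    by (simp add: space_surface_measure)
qed

lemma borel_subsets_subset: "borel_subsets \<Omega> \<subseteq> Pow \<Omega>"
  by (auto simp: sets_restrict_space)

lemma space_BV_variation: "space (BV_variation \<Omega> g) = \<Omega>"
  using borel_subsets_subset
  by (simp add: BV_variation_def variation_measure_def space_measure_of_conv)

lemma sets_BV_variation: "sets (BV_variation \<Omega> g) = borel_subsets \<Omega>"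
  using sets.sigma_sets_eq[of "restrict_space borel \<Omega> :: plane measure"] borel_subsets_subset[of \<Omega>]
  by (simp add: BV_variation_def variation_measure_def sets_measure_of_conv space_restrict_space)

lemma finite_measure_BV_variation:
  assumes "g \<in> BV \<Omega>"
  shows "finite_measure (BV_variation \<Omega> g)"
proof (rule finite_measureI)
  have "has_BV_derivative \<Omega> g (BV_deriv \<Omega> g)"
    using assms someI_ex[of "has_BV_derivative \<Omega> g"] by (simp add: BV_deriv_def BV_def)
  then have "total_variation \<Omega> (BV_deriv \<Omega> g) \<Omega> < \<infinity>"
    by (simp add: has_BV_derivative_def)
  moreover have "emeasure (BV_variation \<Omega> g) \<Omega> \<le> total_variation \<Omega> (BV_deriv \<Omega> g) \<Omega>"
    unfolding BV_variation_def variation_measure_def by (rule emeasure_measure_of_le)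
  ultimately have "emeasure (BV_variation \<Omega> g) \<Omega> < \<infinity>" by (rule le_less_trans[rotated])
  then show "emeasure (BV_variation \<Omega> g) (space (BV_variation \<Omega> g)) \<noteq> \<infinity>"
    by (simp add: space_BV_variation)
qed

section \<open>Exchanging the integrals\<close>

text \<open>Measurability is known only for each fixed direction. Linearity reduces a direction that
  varies with \<open>y\<close> to the two coordinate directions, with measurable coefficients.\<close>

lemma measurable_linear_in_varying_direction:
  fixes k :: "'a \<Rightarrow> 'b \<Rightarrow> real^'n \<Rightarrow> real"
  assumes lin: "\<And>z y. z \<in> space N \<Longrightarrow> y \<in> space M \<Longrightarrow> linear (k z y)"
    and meas: "\<And>d. (\<lambda>(z, y). k z y d) \<in> borel_measurable (N \<Otimes>\<^sub>M M)"
    and \<nu>: "\<nu> \<in> borel_measurable M"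
  shows "(\<lambda>(z, y). k z y (\<nu> y)) \<in> borel_measurable (N \<Otimes>\<^sub>M M)"
proof -
  have expand: "k z y d = (\<Sum>i\<in>UNIV. d $ i * k z y (axis i 1))"
    if "z \<in> space N" "y \<in> space M" for z y d
  proof -
    have "k z y d = k z y (\<Sum>i\<in>UNIV. d $ i *\<^sub>R axis i 1)"
      by (simp add: basis_expansion flip: scalar_mult_eq_scaleR)
    then show ?thesis
      using lin[OF that] by (simp add: linear_sum linear_cmul)
  qed
  have comp: "(\<lambda>y. \<nu> y $ i) \<in> borel_measurable M" for i
    using \<nu> by (intro borel_measurable_continuous_on[OF _ \<nu>]) (intro continuous_intros)
  have "(\<lambda>p. \<Sum>i\<in>UNIV. \<nu> (snd p) $ i * (case p of (z, y) \<Rightarrow> k z y (axis i 1)))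
      \<in> borel_measurable (N \<Otimes>\<^sub>M M)"
    by (intro borel_measurable_sum borel_measurable_times meas
        measurable_compose[OF measurable_snd comp])
  then show ?thesis
    by (rule measurable_cong[THEN iffD2, rotated]) (auto simp: space_pair_measure intro: expand)
qed

lemma nn_integral_L1_norm_swap:
  assumes "sigma_finite_measure N" "sigma_finite_measure M"
    and \<Phi>: "(\<lambda>(z, y). \<Phi> z y) \<in> borel_measurable (N \<Otimes>\<^sub>M M)"
  shows "(\<integral>\<^sup>+y. L1_norm N (\<lambda>z. \<Phi> z y) \<partial>M) = (\<integral>\<^sup>+z. (\<integral>\<^sup>+y. ennreal \<bar>\<Phi> z y\<bar> \<partial>M) \<partial>N)"
proof -
  interpret N: sigma_finite_measure N by fact
  interpret M: sigma_finite_measure M by fact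
  interpret pair_sigma_finite N M ..
  have "(\<lambda>(z, y). ennreal \<bar>\<Phi> z y\<bar>) \<in> borel_measurable (N \<Otimes>\<^sub>M M)"
    using \<Phi> by (simp add: case_prod_unfold)
  then show ?thesis unfolding L1_norm_def by (rule Fubini')
qed

text \<open>The equality case of the triangle inequality for integrals; this is where the sign condition
  on the kernel enters.\<close>

lemma nn_integral_abs_eq_abs_integral:
  fixes h :: "'a \<Rightarrow> real"
  assumes h: "integrable M h"
    and sign: "(\<forall>y\<in>space M. h y \<ge> 0) \<or> (\<forall>y\<in>space M. h y \<le> 0)"
  shows "(\<integral>\<^sup>+y. ennreal \<bar>h y\<bar> \<partial>M) = ennreal \<bar>LINT y|M. h y\<bar>"
proof -
  have "(LINT y|M. \<bar>h y\<bar>) = \<bar>LINT y|M. h y\<bar>"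
    using sign
  proof
    assume nonneg: "\<forall>y\<in>space M. h y \<ge> 0"
    then have "(LINT y|M. \<bar>h y\<bar>) = (LINT y|M. h y)"
      by (intro Bochner_Integration.integral_cong) auto
    moreover have "(LINT y|M. h y) \<ge> 0" using nonneg by (intro integral_nonneg_AE AE_I2) auto
    ultimately show ?thesis by simp
  next
    assume nonpos: "\<forall>y\<in>space M. h y \<le> 0"
    then have "(LINT y|M. \<bar>h y\<bar>) = (LINT y|M. - h y)"
      by (intro Bochner_Integration.integral_cong) auto
    moreover have "(LINT y|M. - h y) \<ge> 0" using nonpos by (intro integral_nonneg_AE AE_I2) auto
    ultimately show ?thesis by simp
  qed
  then show ?thesis
    using nn_integral_eq_integral[OF integrable_abs[OF h]] by simp
qed

lemma abs_integral_le_nn_integral_abs: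
  fixes h :: "'a \<Rightarrow> real"
  assumes "integrable M h"
  shows "ennreal \<bar>LINT y|M. h y\<bar> \<le> (\<integral>\<^sup>+y. ennreal \<bar>h y\<bar> \<partial>M)"
  using nn_integral_eq_integral[OF integrable_abs[OF assms]]
  by (simp add: ennreal_leI integral_abs_bound)

section \<open>Optimality\<close>

theorem theorem4p2:
  fixes \<Omega> :: "plane set"
    and K :: "(plane \<Rightarrow> real) \<Rightarrow> (plane \<Rightarrow> real)"
    and G :: "plane \<Rightarrow> plane \<Rightarrow> real"
    and nu :: "(plane \<Rightarrow> real) \<Rightarrow> plane \<Rightarrow> plane"
    and q :: "plane \<Rightarrow> plane"
    and fstar :: "plane \<Rightarrow> real"
  assumes domain: "bounded_lipschitz_domain \<Omega>"
    and K_operator: "linear_operator_L2 (lebesgue_on \<Omega>) (surface_measure \<Omega>) K"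
    and green: "neumann_green \<Omega> G"
    and nu: "\<forall>f\<in>BV \<Omega>. polar_decomposition \<Omega> (BV_deriv \<Omega> f) (nu f)"
    and KG_linear: "\<forall>y\<in>\<Omega>. \<forall>z\<in>frontier \<Omega>. linear (\<lambda>d. K_gradG K G y d z)"
    and KG_L1: "\<forall>y\<in>\<Omega>. \<forall>d. integrable (surface_measure \<Omega>) (K_gradG K G y d)"
    and KG_measurable: "\<forall>d. (\<lambda>(z, y). K_gradG K G y d z)
      \<in> borel_measurable (surface_measure \<Omega> \<Otimes>\<^sub>M restrict_space borel \<Omega>)"
    and KG_interchange: "\<forall>f\<in>BV \<Omega>. AE z in surface_measure \<Omega>.
      integrable (BV_variation \<Omega> f) (\<lambda>y. K_gradG K G y (nu f y) z) \<and>
      K f z = (LINT y|BV_variation \<Omega> f. K_gradG K G y (nu f y) z)"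
    and K_one: "AE z in surface_measure \<Omega>. K (\<lambda>_. 1) z = 0"
    and fstar: "fstar \<in> BV \<Omega>"
    and sign: "\<forall>z\<in>frontier \<Omega>.
      (\<forall>y\<in>\<Omega>. sgn (K_gradG K G y (nu fstar y) z) \<ge> 0) \<or>
      (\<forall>y\<in>\<Omega>. sgn (K_gradG K G y (nu fstar y) z) \<le> 0)"
    and q: "\<forall>y\<in>\<Omega>. is_arg_max (\<lambda>d. L1_norm (surface_measure \<Omega>) (K_gradG K G y d))
      (\<lambda>d. norm d = 1) (q y)"
    and nu_q: "AE y in BV_variation \<Omega> fstar. nu fstar y = q y"
  shows "is_arg_min (weighted_TV \<Omega> (weight \<Omega> K G))
    (\<lambda>g. g \<in> BV \<Omega> \<and> (AE z in surface_measure \<Omega>. K g z = K fstar z)) fstar"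
proof -
  let ?N = "surface_measure \<Omega>"
  let ?k = "\<lambda>g z y. K_gradG K G y (nu g y) z"
  have "finite_measure ?N" using domain by (rule finite_measure_surface)
  then have sfN: "sigma_finite_measure ?N" by (rule finite_measure.axioms(1))
  have swap: "(\<integral>\<^sup>+y. L1_norm ?N (K_gradG K G y (nu g y)) \<partial>BV_variation \<Omega> g)
      = (\<integral>\<^sup>+z. (\<integral>\<^sup>+y. ennreal \<bar>?k g z y\<bar> \<partial>BV_variation \<Omega> g) \<partial>?N)"
    if g: "g \<in> BV \<Omega>" for g
  proof -
    let ?M = "BV_variation \<Omega> g"
    have sfM: "sigma_finite_measure ?M"
      using finite_measure_BV_variation[OF g] by (rule finite_measure.axioms(1))
    have sets_eq: "sets ?M = sets (restrict_space borel \<Omega>)" by (rule sets_BV_variation)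
    have "nu g \<in> borel_measurable (restrict_space borel \<Omega>)"
      using nu g by (simp add: polar_decomposition_def)
    then have nu_g: "nu g \<in> borel_measurable ?M"
      by (simp add: measurable_cong_sets[OF sets_eq refl])
    have "sets (?N \<Otimes>\<^sub>M ?M) = sets (?N \<Otimes>\<^sub>M restrict_space borel \<Omega>)"
      by (intro sets_pair_measure_cong refl sets_eq)
    then have meas: "(\<lambda>(z, y). K_gradG K G y d z) \<in> borel_measurable (?N \<Otimes>\<^sub>M ?M)" for d
      using KG_measurable measurable_cong_sets by blast
    have "(\<lambda>(z, y). ?k g z y) \<in> borel_measurable (?N \<Otimes>\<^sub>M ?M)"
      using KG_linear
      by (intro measurable_linear_in_varying_direction[OF _ meas nu_g])
        (simp add: space_surface_measure space_BV_variation)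
    then show ?thesis by (rule nn_integral_L1_norm_swap[OF sfN sfM])
  qed
  have data_le: "L1_norm ?N (K g) \<le> weighted_TV \<Omega> (weight \<Omega> K G) g" if g: "g \<in> BV \<Omega>" for g
  proof -
    have "AE z in ?N. ennreal \<bar>K g z\<bar> \<le> (\<integral>\<^sup>+y. ennreal \<bar>?k g z y\<bar> \<partial>BV_variation \<Omega> g)"
      using bspec[OF KG_interchange g]
      by eventually_elim (simp add: abs_integral_le_nn_integral_abs)
    then have "L1_norm ?N (K g)
        \<le> (\<integral>\<^sup>+z. (\<integral>\<^sup>+y. ennreal \<bar>?k g z y\<bar> \<partial>BV_variation \<Omega> g) \<partial>?N)"
      unfolding L1_norm_def by (rule nn_integral_mono_AE)
    also have "\<dots> = (\<integral>\<^sup>+y. L1_norm ?N (K_gradG K G y (nu g y)) \<partial>BV_variation \<Omega> g)"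
      using swap[OF g] by simp
    also have "\<dots> \<le> weighted_TV \<Omega> (weight \<Omega> K G) g"
      unfolding weighted_TV_def
    proof (rule nn_integral_mono_AE)
      have "AE y in BV_variation \<Omega> g. norm (nu g y) = 1"
        using nu g unfolding polar_decomposition_def BV_variation_def by blast
      then show "AE y in BV_variation \<Omega> g. L1_norm ?N (K_gradG K G y (nu g y)) \<le> weight \<Omega> K G y"
        unfolding weight_def by eventually_elim (auto intro: SUP_upper)
    qed
    finally show ?thesis .
  qed
  have fstar_eq: "weighted_TV \<Omega> (weight \<Omega> K G) fstar = L1_norm ?N (K fstar)"
  proof -
    have weight_q: "weight \<Omega> K G y = L1_norm ?N (K_gradG K G y (q y))" if "y \<in> \<Omega>" for y
      using q that unfolding weight_def is_arg_max_def
      by (intro antisym SUP_least SUP_upper) (auto simp: not_less)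
    have "AE y in BV_variation \<Omega> fstar.
        weight \<Omega> K G y = L1_norm ?N (K_gradG K G y (nu fstar y))"
      using nu_q AE_space by eventually_elim (simp add: weight_q space_BV_variation)
    then have "weighted_TV \<Omega> (weight \<Omega> K G) fstar
        = (\<integral>\<^sup>+y. L1_norm ?N (K_gradG K G y (nu fstar y)) \<partial>BV_variation \<Omega> fstar)"
      unfolding weighted_TV_def by (rule nn_integral_cong_AE)
    also have "\<dots> = (\<integral>\<^sup>+z. (\<integral>\<^sup>+y. ennreal \<bar>?k fstar z y\<bar> \<partial>BV_variation \<Omega> fstar) \<partial>?N)"
      by (rule swap[OF fstar])
    also have "\<dots> = L1_norm ?N (K fstar)"
      unfolding L1_norm_def
    proof (rule nn_integral_cong_AE)
      show "AE z in ?N. (\<integral>\<^sup>+y. ennreal \<bar>?k fstar z y\<bar> \<partial>BV_variation \<Omega> fstar) = ennreal \<bar>K fstar z\<bar>"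
        using bspec[OF KG_interchange fstar] AE_space
      proof eventually_elim
        case (elim z)
        then have "z \<in> frontier \<Omega>" by (simp add: space_surface_measure)
        then have "(\<forall>y\<in>\<Omega>. ?k fstar z y \<ge> 0) \<or> (\<forall>y\<in>\<Omega>. ?k fstar z y \<le> 0)"
          using sign by simp
        then show ?case
          using elim nn_integral_abs_eq_abs_integral[of "BV_variation \<Omega> fstar" "?k fstar z"]
          by (simp add: space_BV_variation)
      qed
    qed
    finally show ?thesis .
  qed
  have "weighted_TV \<Omega> (weight \<Omega> K G) fstar \<le> weighted_TV \<Omega> (weight \<Omega> K G) g"
    if g: "g \<in> BV \<Omega>" and Kg: "AE z in ?N. K g z = K fstar z" for g
  proof -
    have "L1_norm ?N (K fstar) = L1_norm ?N (K g)"
      unfolding L1_norm_def using Kg by (intro nn_integral_cong_AE) auto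
    then show ?thesis using fstar_eq data_le[OF g] by simp
  qed
  then show ?thesis
    using fstar by (auto simp: is_arg_min_def not_less)
qed

end
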